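(* Let $U\subset\mathbb R^n\times\mathbb R^m$ and $\alpha_U>0$ be such that the KKT error bound $$\alpha_U\operatorname{dist}(u,W^\star)\le\operatorname{dist}(0,\mathcal T(u))\qquad\forall u\in U$$ holds. Let $\mathcal K\subset\mathbb R^n\times\mathbb R^m$ satisfy $\widehat{\mathcal T}(\mathcal K)\cup\widehat{\mathcal T}_{\rm lin}(\mathcal K)\subset U$. Then: (i) For all $w\in\mathcal K$, $\ \alpha^E_{{\rm ex},U}\operatorname{dist}(w,W^\star)\le\|w-\widehat{\mathcal T}(w)\|$ with $\alpha^E_{{\rm ex},U}:=\dfrac{\alpha_U}{\alpha_U+\|\mathcal M\|}$. (ii) For all $w\in\mathcal K$, $\ \alpha^E_{{\rm lin},U}\operatorname{dist}(w,W^\star)\le\|w-\widehat{\mathcal T}_{\rm lin}(w)\|$ with $\alpha^E_{{\rm lin},U}:=\dfrac{\alpha_U}{\alpha_U+\|\mathcal M\|+L_h}$. (iii) If $\mathcal M\succ0$, then both maps $F\in\{\widehat{\mathcal T},\widehat{\mathcal T}_{\rm lin}\}$ satisfy the sharpness condition $$\alpha\operatorname{dist}_{\mathcal M}(w,W^\star)\le\|w-F(w)\|_{\mathcal M}\qquad\forall w\in\mathcal K,$$ with $\alpha=\alpha^E_{{\rm ex},U}\sqrt{\lambda_{\min}(\mathcal M)/\lambda_{\max}(\mathcal M)}$ for $F=\widehat{\mathcal T}$ and $\alpha=\alpha^E_{{\rm lin},U}\sqrt{\lambda_{\min}(\mathcal M)/\lambda_{\max}(\mathcal M)}$ for $F=\widehat{\mathcal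 T}_{\rm lin}$.
   Context: Setting: $A\in\mathbb R^{m\times n}$, $b\in\mathbb R^m$, $\sigma\ge0$; $f:\mathbb R^n\to\mathbb R$ is convex and continuously differentiable with Lipschitz continuous gradient; $g:\mathbb R^n\to(-\infty,+\infty]$ is proper, closed and convex; $P\in\mathbb R^{n\times n}$, $Q\in\mathbb R^{m\times m}$ are self-adjoint positive semidefinite; $h:\mathbb R^n\to\mathbb R$ is convex and continuously differentiable with $L_h$-Lipschitz gradient and $f-h+\frac\sigma2\|A\cdot-b\|^2$ is convex. Define $$\mathcal M=\begin{pmatrix} P & A^\top \\ A & Q \end{pmatrix}\succeq0,\qquad \mathcal T(x,y)=\begin{pmatrix} \nabla f(x)+\partial g(x)-A^\top y+\sigma A^\top(Ax-b) \\ Ax-b \end{pmatrix},\qquad W^\star:=\mathcal T^{-1}(0),$$ $\mathcal B_h(x,y)=(\nabla h(x),0)$, $\mathcal A_h:=\mathcal T-\mathcal B_h$, and assume $W^\star\neq\emptyset$. The exact map is $\widehat{\mathcal T}:=(\mathcal M+\mathcal T)^{-1}\mathcal M$ and the linearized map is $\widehat{\mathcal T}_{\rm lin}(w):=(\mathcal M+\mathcal A_h)^{-1}(\mathcal Mw-\mathcal B_h(w))$; both are assumed to be single-valued and everywhere defined on $\mathbb R^n\times\mathbb R^m$ (this holds e.g. when $Q\succ0$ and $P-A^\top Q^{-1}A\succ0$). Notation: $\|w\|_{\mathcal M}=\sqrt{\langle w,\mathcal Mw\rangle}$, $\operatorname{dist}_{\mathcal M}(w,S)=\inf_{u\in S}\|w-u\|_{\mathcal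 M}$; unsubscripted norms/distances are Euclidean, and $\|\mathcal M\|$ is the operator norm. *)

theory Defs
  imports "HOL-Analysis.Analysis"
begin

definition proper_fun :: "('a \<Rightarrow> ereal) \<Rightarrow> bool" where
  "proper_fun g \<longleftrightarrow> (\<exists>x. g x < \<infinity>) \<and> (\<forall>x. g x > -\<infinity>)"

definition ext_epigraph :: "('a \<Rightarrow> ereal) \<Rightarrow> ('a \<times> real) set" where
  "ext_epigraph g = {(x, r). g x \<le> ereal r}"

definition closed_fun :: "('a::topological_space \<Rightarrow> ereal) \<Rightarrow> bool" where
  "closed_fun g \<longleftrightarrow> closed (ext_epigraph g)"

definition convex_fun :: "('a::real_vector \<Rightarrow> ereal) \<Rightarrow> bool" where
  "convex_fun g \<longleftrightarrow> convex (ext_epigraph g)"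

text \<open>For proper \<open>g\<close> this is empty at every point where \<open>g\<close> is infinite.\<close>

definition subdifferential :: "('a::real_inner \<Rightarrow> ereal) \<Rightarrow> 'a \<Rightarrow> 'a set" where
  "subdifferential g x = {v. \<forall>z. g x + ereal (v \<bullet> (z - x)) \<le> g z}"

text \<open>The self-adjointness clause already forces the operator to be linear.\<close>

definition psd_op :: "('a::real_inner \<Rightarrow> 'a) \<Rightarrow> bool" where
  "psd_op F \<longleftrightarrow> (\<forall>u v. F u \<bullet> v = u \<bullet> F v) \<and> (\<forall>v. 0 \<le> v \<bullet> F v)"

definition pd_op :: "('a::real_inner \<Rightarrow> 'a) \<Rightarrow> bool" where
  "pd_op F \<longleftrightarrow> (\<forall>u v. F u \<bullet> v = u \<bullet> F v) \<and> (\<forall>v. v \<noteq> 0 \<longrightarrow> 0 < v \<bullet> F v)"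

definition eigvals :: "('a::real_vector \<Rightarrow> 'a) \<Rightarrow> real set" where
  "eigvals F = {c. \<exists>v. v \<noteq> 0 \<and> F v = c *\<^sub>R v}"

definition lambda_min :: "('a::real_vector \<Rightarrow> 'a) \<Rightarrow> real" where
  "lambda_min F = Min (eigvals F)"

definition lambda_max :: "('a::real_vector \<Rightarrow> 'a) \<Rightarrow> real" where
  "lambda_max F = Max (eigvals F)"

definition op_norm :: "('a::real_inner \<Rightarrow> 'a) \<Rightarrow> 'a \<Rightarrow> real" where
  "op_norm M w = sqrt (w \<bullet> M w)"

text \<open>Only used for nonempty \<open>S\<close>; for psd \<open>M\<close> the infimum is then over a set bounded below.\<close>

definition op_dist :: "('a::real_inner \<Rightarrow> 'a) \<Rightarrow> 'a \<Rightarrow> 'a set \<Rightarrow> real" where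
  "op_dist M w S = (INF u\<in>S. op_norm M (w - u))"

text \<open>Distance with the convention that the distance to the empty set is \<open>\<infinity>\<close>; in contrast,
  \<^const>\<open>infdist\<close> returns 0 there, which would be wrong for a set-valued operator off its domain.\<close>

definition ext_dist :: "'a::metric_space \<Rightarrow> 'a set \<Rightarrow> ereal" where
  "ext_dist w S = (INF u\<in>S. ereal (dist w u))"

definition op_inv :: "('a \<Rightarrow> 'b set) \<Rightarrow> 'b \<Rightarrow> 'a set" where
  "op_inv F v = {u. v \<in> F u}"

definition op_add :: "('a \<Rightarrow> 'b::plus) \<Rightarrow> ('a \<Rightarrow> 'b set) \<Rightarrow> 'a \<Rightarrow> 'b set" where
  "op_add S F u = (\<lambda>t. S u + t) ` F u"

text \<open>The possibly multivalued maps \<open>(M + T)\<^sup>-\<^sup>1 M\<close> and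
  \<open>(M + (T - B))\<^sup>-\<^sup>1 (M - B)\<close>.\<close>

definition exact_map :: "('a \<Rightarrow> 'a::ab_group_add) \<Rightarrow> ('a \<Rightarrow> 'a set) \<Rightarrow> 'a \<Rightarrow> 'a set" where
  "exact_map M T w = op_inv (op_add M T) (M w)"

definition lin_map ::
  "('a \<Rightarrow> 'a::ab_group_add) \<Rightarrow> ('a \<Rightarrow> 'a set) \<Rightarrow> ('a \<Rightarrow> 'a) \<Rightarrow> 'a \<Rightarrow> 'a set" where
  "lin_map M T B w = op_inv (op_add M (op_add (\<lambda>u. - B u) T)) (M w - B w)"

definition block_op ::
  "real^'n^'n \<Rightarrow> real^'n^'m \<Rightarrow> real^'m^'m \<Rightarrow>
   (real^'n) \<times> (real^'m) \<Rightarrow> (real^'n) \<times> (real^'m)" where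
  "block_op P A Q = (\<lambda>(x, y). (P *v x + transpose A *v y, A *v x + Q *v y))"

definition kkt_op ::
  "(real^'n \<Rightarrow> real^'n) \<Rightarrow> (real^'n \<Rightarrow> ereal) \<Rightarrow> real^'n^'m \<Rightarrow> real^'m \<Rightarrow> real \<Rightarrow>
   (real^'n) \<times> (real^'m) \<Rightarrow> ((real^'n) \<times> (real^'m)) set" where
  "kkt_op grad_f g A b \<sigma> = (\<lambda>(x, y).
     {(grad_f x + v - transpose A *v y + \<sigma> *\<^sub>R (transpose A *v (A *v x - b)), A *v x - b) | v.
        v \<in> subdifferential g x})"

definition grad_op ::
  "(real^'n \<Rightarrow> real^'n) \<Rightarrow> (real^'n) \<times> (real^'m) \<Rightarrow> (real^'n) \<times> (real^'m)" where
  "grad_op grad_h = (\<lambda>(x, y). (grad_h x, 0))"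

end

theory Submission
  imports Defs
begin

text \<open>If \<open>u\<close> is the image of \<open>w\<close>, then the inclusion defining \<open>u\<close> exhibits an element of \<open>T u\<close>:
  \<open>M (w - u)\<close> for the exact map and \<open>M (w - u) - (B w - B u)\<close> for the linearized one. Its norm is
  at most \<open>c * norm (w - u)\<close>, with \<open>c\<close> the norm of \<open>M\<close>, increased by \<open>L\<^sub>h\<close> in the linearized case.
  The error bound at \<open>u\<close> and the triangle inequality through \<open>u\<close> give (i) and (ii). Part (iii)
  compares the two norms by the extreme eigenvalues of \<open>M\<close>, which are the extreme values of its
  Rayleigh quotient.\<close>

section \<open>Extreme eigenvalues of self-adjoint operators\<close>

lemma self_adjoint_linear:
  fixes F :: "'a::real_inner \<Rightarrow> 'a"
  assumes "\<And>u v. F u \<bullet> v = u \<bullet> F v"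
  shows "linear F"
proof (rule linearI)
  show "F (x + y) = F x + F y" for x y
    by (rule vector_eq_ldot[THEN iffD1])
      (metis assms inner_add_left inner_add_right inner_commute)
  show "F (r *\<^sub>R x) = r *\<^sub>R F x" for r x
    by (rule vector_eq_ldot[THEN iffD1])
      (metis assms inner_scaleR_left inner_scaleR_right inner_commute)
qed

text \<open>Along \<open>v - s * F v\<close> the quadratic form starts at 0 with slope -2 times the
  squared norm of \<open>F v\<close>. A nonzero \<open>F v\<close> would therefore make it negative
  for small positive \<open>s\<close>.\<close>

lemma psd_op_eq_0:
  assumes "psd_op F" and "v \<bullet> F v = 0"
  shows "F v = 0"
proof -
  have sa: "F u \<bullet> x = u \<bullet> F x" and nonneg: "0 \<le> x \<bullet> F x" for u x
    using assms(1) by (auto simp: psd_op_def)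
  interpret linear F using sa by (rule self_adjoint_linear)
  \<comment> \<open>The summand 1 keeps the denominator positive when \<open>k = 0\<close>. This
    choice gives \<open>s * k = w \<bullet> w - s\<close>, so the second factor below becomes
    \<open>- (w \<bullet> w) - s\<close>, which is negative.\<close>
  define w k s where "w = F v" and "k = w \<bullet> F w" and "s = (w \<bullet> w) / (k + 1)"
  have k: "0 \<le> k" by (simp add: k_def nonneg)
  have "v \<bullet> F w = w \<bullet> w" using sa[of v w] by (simp add: w_def)
  moreover have "w \<bullet> F v = w \<bullet> w" by (simp add: w_def)
  ultimately have "(v - s *\<^sub>R w) \<bullet> F (v - s *\<^sub>R w) = s * (s * k - 2 * (w \<bullet> w))"
    by (simp add: diff scale inner_diff_left inner_diff_right assms(2) k_def algebra_simps)
  then have ge: "0 \<le> s * (s * k - 2 * (w \<bullet> w))" using nonneg by metis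
  have "w \<bullet> w = 0"
  proof (rule ccontr)
    assume "w \<bullet> w \<noteq> 0"
    then have pos: "0 < w \<bullet> w" by simp
    then have "0 < s" using k by (simp add: s_def)
    moreover have "s * (k + 1) = w \<bullet> w" using k by (simp add: s_def)
    then have "s * k = w \<bullet> w - s" by (simp add: algebra_simps)
    ultimately show False using ge pos by (simp add: zero_le_mult_iff)
  qed
  then show ?thesis by (simp add: w_def)
qed

text \<open>The Rayleigh quotient attains its minimum \<open>c\<close> on the unit sphere at some
  \<open>e\<close>. Then \<open>F - c\<close> is positive semidefinite with a form vanishing at
  \<open>e\<close>, so \<open>psd_op_eq_0\<close> makes \<open>e\<close> an eigenvector, without
  differentiating the quotient.\<close>

lemma self_adjoint_least_eigval:
  fixes F :: "'a::euclidean_space \<Rightarrow> 'a"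
  assumes sa: "\<And>u v. F u \<bullet> v = u \<bullet> F v"
  obtains c where "c \<in> eigvals F" "\<And>v. c * (v \<bullet> v) \<le> v \<bullet> F v"
proof -
  interpret linear F using sa by (rule self_adjoint_linear)
  have "continuous_on (sphere 0 1) (\<lambda>v. v \<bullet> F v)"
    by (intro continuous_intros linear_continuous_on)
      (simp add: linear_axioms linear_conv_bounded_linear[symmetric])
  \<comment> \<open>The sphere is compact, and nonempty because a Euclidean space has positive
    dimension.\<close>
  then have "\<exists>e\<in>sphere 0 1. \<forall>v\<in>sphere 0 1. e \<bullet> F e \<le> v \<bullet> F v"
    by (intro continuous_attains_inf) simp_all
  then obtain e where e: "e \<in> sphere 0 1" and min: "\<And>v. v \<in> sphere 0 1 \<Longrightarrow> e \<bullet> F e \<le> v \<bullet> F v"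
    by blast
  define c where "c = e \<bullet> F e"
  have bound: "c * (v \<bullet> v) \<le> v \<bullet> F v" for v
  proof (cases "v = 0")
    case False
    have "c \<le> (inverse (norm v) *\<^sub>R v) \<bullet> F (inverse (norm v) *\<^sub>R v)"
      unfolding c_def by (rule min) (simp add: False)
    also have "\<dots> = (v \<bullet> F v) / (v \<bullet> v)"
      by (simp add: scale divide_inverse power2_norm_eq_inner[symmetric] power2_eq_square)
    finally show ?thesis using False by (simp add: pos_le_divide_eq)
  qed (simp add: zero)
  have "psd_op (\<lambda>v. F v - c *\<^sub>R v)"
    using bound by (auto simp: psd_op_def inner_diff_left inner_diff_right sa)
  moreover have "e \<bullet> (F e - c *\<^sub>R e) = 0"
    using e by (simp add: inner_diff_right c_def power2_norm_eq_inner[symmetric])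
  ultimately have "F e - c *\<^sub>R e = 0" by (rule psd_op_eq_0)
  then have "c \<in> eigvals F" using e by (auto simp: eigvals_def intro!: exI[of _ e])
  then show thesis using bound that by blast
qed

text \<open>Negating the operator negates its eigenvalues and turns the minimum of the Rayleigh
  quotient into the maximum.\<close>

lemma self_adjoint_greatest_eigval:
  fixes F :: "'a::euclidean_space \<Rightarrow> 'a"
  assumes sa: "\<And>u v. F u \<bullet> v = u \<bullet> F v"
  obtains c where "c \<in> eigvals F" "\<And>v. v \<bullet> F v \<le> c * (v \<bullet> v)"
proof -
  obtain c where c: "c \<in> eigvals (\<lambda>v. - F v)" "\<And>v. c * (v \<bullet> v) \<le> v \<bullet> - F v"
    by (rule self_adjoint_least_eigval[of "\<lambda>v. - F v"]) (auto simp: sa)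
  from c(1) have "- c \<in> eigvals F"
    by (auto simp: eigvals_def minus_equation_iff[of "F _"])
  moreover have "v \<bullet> F v \<le> - c * (v \<bullet> v)" for v using c(2)[of v] by simp
  ultimately show thesis by (rule that)
qed

text \<open>Eigenvectors of distinct eigenvalues are orthogonal, and finite dimension admits only
  finitely many pairwise orthogonal vectors. Finiteness gives the \<open>Min\<close> and
  \<open>Max\<close> in \<open>lambda_min\<close> and \<open>lambda_max\<close> their
  meaning.\<close>

lemma finite_eigvals:
  fixes F :: "'a::euclidean_space \<Rightarrow> 'a"
  assumes sa: "\<And>u v. F u \<bullet> v = u \<bullet> F v"
  shows "finite (eigvals F)"
proof -
  have "\<forall>c\<in>eigvals F. \<exists>v. v \<noteq> 0 \<and> F v = c *\<^sub>R v" by (auto simp: eigvals_def)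
  then obtain e where e: "\<And>c. c \<in> eigvals F \<Longrightarrow> e c \<noteq> 0 \<and> F (e c) = c *\<^sub>R e c" by metis
  have orth: "e c \<bullet> e d = 0" if "c \<in> eigvals F" "d \<in> eigvals F" "c \<noteq> d" for c d
    using sa[of "e c" "e d"] e[OF that(1)] e[OF that(2)] that(3) by auto
  \<comment> \<open>A vector chosen for two distinct eigenvalues would be orthogonal to itself, yet
    it is nonzero.\<close>
  have "inj_on e (eigvals F)"
    by (rule inj_onI) (metis orth e inner_eq_zero_iff)
  moreover have "finite (e ` eigvals F)"
  proof (rule pairwise_orthogonal_imp_finite)
    show "pairwise orthogonal (e ` eigvals F)"
      using orth by (auto simp: pairwise_def orthogonal_def)
  qed
  ultimately show ?thesis by (metis finite_imageD)
qed

lemma lambda_min_bound: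
  fixes F :: "'a::euclidean_space \<Rightarrow> 'a"
  assumes sa: "\<And>u v. F u \<bullet> v = u \<bullet> F v"
  shows "lambda_min F * (v \<bullet> v) \<le> v \<bullet> F v"
proof -
  obtain c where c: "c \<in> eigvals F" "\<And>v. c * (v \<bullet> v) \<le> v \<bullet> F v"
    using sa by (rule self_adjoint_least_eigval) blast
  have "lambda_min F \<le> c" using c(1) finite_eigvals[OF sa] by (simp add: lambda_min_def)
  then show ?thesis using c(2)[of v] mult_right_mono[of "lambda_min F" c "v \<bullet> v"] by simp
qed

lemma lambda_max_bound:
  fixes F :: "'a::euclidean_space \<Rightarrow> 'a"
  assumes sa: "\<And>u v. F u \<bullet> v = u \<bullet> F v"
  shows "v \<bullet> F v \<le> lambda_max F * (v \<bullet> v)"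
proof -
  obtain c where c: "c \<in> eigvals F" "\<And>v. v \<bullet> F v \<le> c * (v \<bullet> v)"
    using sa by (rule self_adjoint_greatest_eigval) blast
  have "c \<le> lambda_max F" using c(1) finite_eigvals[OF sa] by (simp add: lambda_max_def)
  then show ?thesis using c(2)[of v] mult_right_mono[of c "lambda_max F" "v \<bullet> v"] by simp
qed

text \<open>On an eigenvector the form equals the eigenvalue times a positive number. Both extremes
  belong to the finite nonempty set of eigenvalues and inherit its positivity.\<close>

lemma pd_op_lambda_pos:
  fixes F :: "'a::euclidean_space \<Rightarrow> 'a"
  assumes "pd_op F"
  shows "0 < lambda_min F" and "0 < lambda_max F"
proof -
  have sa: "F u \<bullet> v = u \<bullet> F v" for u v using assms by (auto simp: pd_op_def)
  have "eigvals F \<noteq> {}" using self_adjoint_least_eigval[of F] sa by blast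
  moreover have "0 < c" if "c \<in> eigvals F" for c
  proof -
    from that obtain v where v: "v \<noteq> 0" "F v = c *\<^sub>R v" by (auto simp: eigvals_def)
    then have "0 < v \<bullet> F v" using assms by (auto simp: pd_op_def)
    then show ?thesis using v inner_ge_zero[of v] by (auto simp: zero_less_mult_iff)
  qed
  ultimately show "0 < lambda_min F" "0 < lambda_max F"
    using finite_eigvals[OF sa] Min_in Max_in unfolding lambda_min_def lambda_max_def by blast+
qed

section \<open>Comparing the operator norm and distance with the Euclidean ones\<close>

lemma op_norm_ge:
  fixes F :: "'a::euclidean_space \<Rightarrow> 'a"
  assumes "\<And>u v. F u \<bullet> v = u \<bullet> F v"
  shows "sqrt (lambda_min F) * norm v \<le> op_norm F v"
  using lambda_min_bound[OF assms, of v]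
  by (simp add: op_norm_def norm_eq_sqrt_inner real_sqrt_mult[symmetric])

lemma op_norm_le:
  fixes F :: "'a::euclidean_space \<Rightarrow> 'a"
  assumes "\<And>u v. F u \<bullet> v = u \<bullet> F v"
  shows "op_norm F v \<le> sqrt (lambda_max F) * norm v"
  using lambda_max_bound[OF assms, of v]
  by (simp add: op_norm_def norm_eq_sqrt_inner real_sqrt_mult[symmetric])

lemma op_dist_le:
  fixes F :: "'a::euclidean_space \<Rightarrow> 'a"
  assumes "pd_op F" and "S \<noteq> {}"
  shows "op_dist F w S \<le> sqrt (lambda_max F) * infdist w S"
proof -
  have sa: "F u \<bullet> v = u \<bullet> F v" for u v using assms(1) by (auto simp: pd_op_def)
  have pos: "0 < lambda_max F" using assms(1) by (rule pd_op_lambda_pos)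
  \<comment> \<open>A real infimum is a lower bound only of a set bounded below. The zero vector is
    treated apart because \<open>pd_op\<close> speaks of nonzero vectors.\<close>
  have "0 \<le> op_norm F v" for v
    using assms(1) by (cases "v = 0") (auto simp: op_norm_def pd_op_def less_imp_le)
  then have bdd: "bdd_below ((\<lambda>u. op_norm F (w - u)) ` S)" by (intro bdd_belowI2)
  \<comment> \<open>Dividing first makes the left side a lower bound of all distances, hence of
    their infimum.\<close>
  have "op_dist F w S / sqrt (lambda_max F) \<le> (INF u\<in>S. dist w u)"
  proof (rule cINF_greatest[OF assms(2)])
    fix u assume "u \<in> S"
    then have "op_dist F w S \<le> op_norm F (w - u)"
      unfolding op_dist_def by (rule cINF_lower[OF bdd])
    also have "\<dots> \<le> sqrt (lambda_max F) * norm (w - u)" using sa by (rule op_norm_le)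
    finally show "op_dist F w S / sqrt (lambda_max F) \<le> dist w u"
      using pos by (simp add: dist_norm divide_le_eq mult.commute)
  qed
  then show ?thesis
    using pos assms(2) by (simp add: infdist_notempty divide_le_eq mult.commute)
qed

text \<open>Passing to \<open>op_dist\<close> costs a factor \<open>sqrt (lambda_max F)\<close>,
  which cancels the denominator. The remaining \<open>sqrt (lambda_min F)\<close> is what
  \<open>op_norm_ge\<close> absorbs. The point \<open>u\<close> is arbitrary, so both maps are
  covered.\<close>

lemma sharpness_change_norm:
  fixes F :: "'a::euclidean_space \<Rightarrow> 'a"
  assumes "pd_op F" and "S \<noteq> {}" and "0 \<le> \<alpha>"
    and "\<alpha> * infdist w S \<le> norm (w - u)"
  shows "\<alpha> * sqrt (lambda_min F / lambda_max F) * op_dist F w S \<le> op_norm F (w - u)"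
proof -
  have sa: "F u \<bullet> v = u \<bullet> F v" for u v using assms(1) by (auto simp: pd_op_def)
  note pos = pd_op_lambda_pos[OF assms(1)]
  have "\<alpha> * sqrt (lambda_min F / lambda_max F) * op_dist F w S
      \<le> \<alpha> * sqrt (lambda_min F / lambda_max F) * (sqrt (lambda_max F) * infdist w S)"
    using assms(3) pos by (intro mult_left_mono op_dist_le assms) auto
  also have "\<dots> = sqrt (lambda_min F) * (\<alpha> * infdist w S)"
    using pos by (simp add: real_sqrt_divide)
  also have "\<dots> \<le> sqrt (lambda_min F) * norm (w - u)"
    using assms(4) pos by (intro mult_left_mono) auto
  also have "\<dots> \<le> op_norm F (w - u)" using sa by (rule op_norm_ge)
  finally show ?thesis .
qed

section \<open>From the error bound at the image to the residual at the point\<close>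

lemma error_bound_transfer:
  fixes w u :: "'a::real_normed_vector"
  assumes bound: "ereal (\<alpha> * infdist u W) \<le> ext_dist 0 (T u)"
    and "t \<in> T u" and "norm t \<le> c * norm (w - u)" and "0 < \<alpha>" and "0 \<le> c"
  shows "\<alpha> / (\<alpha> + c) * infdist w W \<le> norm (w - u)"
proof -
  \<comment> \<open>The single element \<open>t\<close> bounds the extended distance by a real
    number, which brings the error bound back to the reals.\<close>
  have "ext_dist 0 (T u) \<le> ereal (dist 0 t)"
    unfolding ext_dist_def using assms(2) by (rule INF_lower)
  with bound have "ereal (\<alpha> * infdist u W) \<le> ereal (dist 0 t)" by (rule order_trans)
  then have "\<alpha> * infdist u W \<le> c * norm (w - u)" using assms(3) by simp
  \<comment> \<open>Going from \<open>u\<close> back to \<open>w\<close> adds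
    \<open>\<alpha>\<close> to the factor \<open>c\<close>; this is the origin of the denominator
    \<open>\<alpha> + c\<close>.\<close>
  moreover have "\<alpha> * infdist w W \<le> \<alpha> * (infdist u W + norm (w - u))"
    using infdist_triangle[of w W u] assms(4) by (simp add: dist_norm)
  ultimately have "\<alpha> * infdist w W \<le> norm (w - u) * (\<alpha> + c)" by (simp add: algebra_simps)
  then show ?thesis using assms(4,5) by (simp add: divide_le_eq)
qed

lemma exact_map_residual:
  assumes "u \<in> exact_map M T w"
  shows "M w - M u \<in> T u"
  using assms by (auto simp: exact_map_def op_inv_def op_add_def)

lemma lin_map_residual:
  assumes "u \<in> lin_map M T B w"
  shows "M w - M u - (B w - B u) \<in> T u"
proof -
  obtain t where "t \<in> T u" "M w - B w = M u + (- B u + t)"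
    using assms by (auto simp: lin_map_def op_inv_def op_add_def)
  moreover from this(2) have "t = M w - M u - (B w - B u)" by (simp add: algebra_simps)
  ultimately show ?thesis by simp
qed

text \<open>The second component is constant and projection to the first is nonexpansive, so the
  constant of \<open>G\<close> carries over to the product space.\<close>

lemma grad_op_lipschitz:
  fixes G :: "real^'n \<Rightarrow> real^'n" and w u :: "(real^'n) \<times> (real^'m)"
  assumes "L-lipschitz_on UNIV G"
  shows "norm (grad_op G w - grad_op G u) \<le> L * norm (w - u)"
proof -
  have "norm (grad_op G w - grad_op G u) = dist (G (fst w)) (G (fst u))"
    by (simp add: grad_op_def case_prod_unfold dist_norm norm_Pair)
  also have "\<dots> \<le> L * dist (fst w) (fst u)"
    using assms by (rule lipschitz_onD) auto
  also have "\<dots> \<le> L * dist w u"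
    using dist_fst_le lipschitz_on_nonneg[OF assms] by (rule mult_left_mono)
  finally show ?thesis by (simp add: dist_norm)
qed

theorem proposition13:
  fixes A :: "real^'n^'m" and b :: "real^'m" and \<sigma> :: real
    and f h :: "real^'n \<Rightarrow> real" and grad_f grad_h :: "real^'n \<Rightarrow> real^'n"
    and g :: "real^'n \<Rightarrow> ereal"
    and P :: "real^'n^'n" and Q :: "real^'m^'m"
    and L\<^sub>h \<alpha>\<^sub>U :: real
    and M B That Tlin :: "(real^'n) \<times> (real^'m) \<Rightarrow> (real^'n) \<times> (real^'m)"
    and T :: "(real^'n) \<times> (real^'m) \<Rightarrow> ((real^'n) \<times> (real^'m)) set"
    and W U K :: "((real^'n) \<times> (real^'m)) set"
  assumes "\<sigma> \<ge> 0"
    and "convex_on UNIV f"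
    and "\<forall>x. GDERIV f x :> grad_f x"
    and "continuous_on UNIV grad_f"
    and "\<exists>L. L-lipschitz_on UNIV grad_f"
    and "proper_fun g" and "closed_fun g" and "convex_fun g"
    and "psd_op (\<lambda>x. P *v x)" and "psd_op (\<lambda>y. Q *v y)"
    and "convex_on UNIV h"
    and "\<forall>x. GDERIV h x :> grad_h x"
    and "continuous_on UNIV grad_h"
    and "L\<^sub>h-lipschitz_on UNIV grad_h"
    and "convex_on UNIV (\<lambda>x. f x - h x + \<sigma> / 2 * (norm (A *v x - b))\<^sup>2)"
    and M_eq: "M = block_op P A Q" and "psd_op M"
    and T_eq: "T = kkt_op grad_f g A b \<sigma>"
    and W_eq: "W = op_inv T 0" and "W \<noteq> {}"
    and B_eq: "B = grad_op grad_h"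
    and That: "\<forall>w. exact_map M T w = {That w}"
    and Tlin: "\<forall>w. lin_map M T B w = {Tlin w}"
    and "\<alpha>\<^sub>U > 0"
    and error_bound: "\<forall>u\<in>U. ereal (\<alpha>\<^sub>U * infdist u W) \<le> ext_dist 0 (T u)"
    and "That ` K \<union> Tlin ` K \<subseteq> U"
  defines "\<alpha>ex \<equiv> \<alpha>\<^sub>U / (\<alpha>\<^sub>U + onorm M)"
    and "\<alpha>lin \<equiv> \<alpha>\<^sub>U / (\<alpha>\<^sub>U + onorm M + L\<^sub>h)"
  shows "(\<forall>w\<in>K. \<alpha>ex * infdist w W \<le> norm (w - That w))
    \<and> (\<forall>w\<in>K. \<alpha>lin * infdist w W \<le> norm (w - Tlin w))
    \<and> (pd_op M \<longrightarrow>
        (\<forall>w\<in>K. \<alpha>ex * sqrt (lambda_min M / lambda_max M) * op_dist M w W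
                  \<le> op_norm M (w - That w))
      \<and> (\<forall>w\<in>K. \<alpha>lin * sqrt (lambda_min M / lambda_max M) * op_dist M w W
                  \<le> op_norm M (w - Tlin w)))"
proof -
  \<comment> \<open>Linearity comes from self-adjointness; it turns \<open>M w - M u\<close> into
    \<open>M (w - u)\<close>, to which the operator norm applies.\<close>
  have "linear M"
    using \<open>psd_op M\<close> by (intro self_adjoint_linear) (auto simp: psd_op_def)
  then have bl: "bounded_linear M" by (simp add: linear_conv_bounded_linear)
  have M_le: "norm (M w - M u) \<le> onorm M * norm (w - u)" for w u
    using onorm[OF bl, of "w - u"] by (simp add: linear_diff[OF \<open>linear M\<close>])
  have onorm: "0 \<le> onorm M" using bl by (rule onorm_pos_le)
  have L: "0 \<le> L\<^sub>h" using \<open>L\<^sub>h-lipschitz_on UNIV grad_h\<close> by (rule lipschitz_on_nonneg)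
  have exact: "\<alpha>ex * infdist w W \<le> norm (w - That w)" if "w \<in> K" for w
    unfolding \<alpha>ex_def
  proof (rule error_bound_transfer)
    show "ereal (\<alpha>\<^sub>U * infdist (That w) W) \<le> ext_dist 0 (T (That w))"
      using error_bound \<open>That ` K \<union> Tlin ` K \<subseteq> U\<close> that by blast
    show "M w - M (That w) \<in> T (That w)" using That by (intro exact_map_residual) blast
  qed (use M_le onorm \<open>\<alpha>\<^sub>U > 0\<close> in auto)
  have lin: "\<alpha>lin * infdist w W \<le> norm (w - Tlin w)" if "w \<in> K" for w
    \<comment> \<open>Reassociating groups the denominator as
      \<open>\<alpha>\<^sub>U + (onorm M + L\<^sub>h)\<close>, so that \<open>c\<close> is
      \<open>onorm M + L\<^sub>h\<close>.\<close>
    unfolding \<alpha>lin_def add.assoc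
  proof (rule error_bound_transfer)
    show "ereal (\<alpha>\<^sub>U * infdist (Tlin w) W) \<le> ext_dist 0 (T (Tlin w))"
      using error_bound \<open>That ` K \<union> Tlin ` K \<subseteq> U\<close> that by blast
    show "M w - M (Tlin w) - (B w - B (Tlin w)) \<in> T (Tlin w)"
      using Tlin by (intro lin_map_residual) blast
    have "norm (B w - B (Tlin w)) \<le> L\<^sub>h * norm (w - Tlin w)"
      unfolding B_eq using \<open>L\<^sub>h-lipschitz_on UNIV grad_h\<close> by (rule grad_op_lipschitz)
    then show "norm (M w - M (Tlin w) - (B w - B (Tlin w))) \<le> (onorm M + L\<^sub>h) * norm (w - Tlin w)"
      using M_le[of w "Tlin w"] norm_triangle_ineq4[of "M w - M (Tlin w)" "B w - B (Tlin w)"]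
      by (simp add: distrib_right)
  qed (use onorm L \<open>\<alpha>\<^sub>U > 0\<close> in auto)
  \<comment> \<open>The change of norm multiplies inequalities by these constants, so their signs
    matter.\<close>
  have "0 \<le> \<alpha>ex" "0 \<le> \<alpha>lin"
    using onorm L \<open>\<alpha>\<^sub>U > 0\<close> by (auto simp: \<alpha>ex_def \<alpha>lin_def)
  then show ?thesis
    using exact lin sharpness_change_norm[OF _ \<open>W \<noteq> {}\<close>] by blast
qed

end
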